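(* Let $1 \le h < n$ be integers and let $\rho \in \mathfrak{S}_n$ be the permutation that maps $i \in [n]$ to $i+h \bmod n \in [n]$. For every $\pi \in \mathfrak{S}_n$, \[ \{k \in [n-h] : \widehat{\rho \pi}^{-1}(k+h) = \widehat{\rho \pi}^{-1}(k) + 1\} = \{k \in [n-h] : \pi(k) = k\}. \]
   Context: For a positive integer $n$, $[n] := \{1,2,\ldots,n\}$ and $\mathfrak{S}_n$ is the set of permutations of $[n]$. Here $i + h \bmod n$ denotes the unique element of $[n]$ congruent to $i+h$ modulo $n$ (so residues are taken in $\{1,\ldots,n\}$). Products are compositions: $(\rho\pi)(i) = \rho(\pi(i))$. The map $\pi \mapsto \hat\pi$ from $\mathfrak{S}_n$ to itself is the following bijection. Write $\pi$ in cycle form (including fixed points as cycles of length one) \[ (a_1, a_2, \ldots, a_r)(b_1, b_2, \ldots, b_s) \cdots (c_1, c_2, \ldots, c_t), \] where the convention is that $\pi$ sends each entry of a cycle to the next entry (and the last to the first), the leading element of each cycle is the least element of that cycle, and these leading elements form a decreasing sequence: $a_1 > b_1 > \cdots > c_1$. Remove the parentheses to obtain an ordered listing $(a_1,\ldots,a_r,b_1,\ldots,b_s,\ldots,c_1,\ldots,c_t)$ of $[n]$, and define $\hat\pi \in \mathfrak{S}_n$ by letting $(\hat\pi(1),\hat\pi(2),\ldots,\hat\pi(n))$ be this ordered listing. $\widehat{\rho\pi}$ is the result of applying this map to the permutation $\rho\pi$, and $\widehat{\rho\pi}^{-1}$ is the inverse permutation of $\widehat{\rho\pi}$. *)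

theory Defs
  imports "HOL-Combinatorics.Cycles" "HOL-Number_Theory.Cong"
begin

text \<open>
  Permutations of \<open>[n]\<close> are functions on \<^typ>\<open>nat\<close> that permute \<open>{1..n}\<close> (identity elsewhere).
  The residue of \<open>i + h\<close> is taken in \<open>{1..n}\<close>, hence the shift by one around \<open>mod\<close>.
\<close>

definition rotation :: "nat \<Rightarrow> nat \<Rightarrow> nat \<Rightarrow> nat" where
  "rotation n h i = (if i \<in> {1..n} then (i + h - 1) mod n + 1 else i)"

text \<open>
  Here \<open>hat n p\<close> is the permutation written \<open>p\<close> with a hat: its one-line notation is the
  cycle form of \<open>p\<close> without parentheses.
  \<open>support p a\<close> is the cycle \<open>[a, p a, p (p a), \<dots>]\<close> of \<open>p\<close> written from \<open>a\<close>; it is \<open>[a]\<close> for a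
  fixed point.
\<close>

definition cycle_leaders :: "nat \<Rightarrow> (nat \<Rightarrow> nat) \<Rightarrow> nat set" where
  "cycle_leaders n p = {a \<in> {1..n}. a = Min (set (support p a))}"

definition canonical_cycles :: "nat \<Rightarrow> (nat \<Rightarrow> nat) \<Rightarrow> nat list list" where
  "canonical_cycles n p = map (\<lambda>a. support p a) (rev (sorted_list_of_set (cycle_leaders n p)))"

definition hat :: "nat \<Rightarrow> (nat \<Rightarrow> nat) \<Rightarrow> nat \<Rightarrow> nat" where
  "hat n p i = (if i \<in> {1..n} then concat (canonical_cycles n p) ! (i - 1) else i)"

lemma rotation_cong:
  assumes "i \<in> {1..n}"
  shows "rotation n h i \<in> {1..n}" and "[rotation n h i = i + h] (mod n)"
proof -
  have n: "n > 0" using assms by auto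
  show "rotation n h i \<in> {1..n}"
    unfolding rotation_def using assms mod_less_divisor[OF n, of "i + h - 1"]
    by (simp add: Suc_leI)
  have "((i + h - 1) mod n + 1) mod n = (i + h - 1 + 1) mod n"
    by (rule mod_add_left_eq)
  then show "[rotation n h i = i + h] (mod n)"
    using assms by (simp add: rotation_def cong_def)
qed

lemma rotation_permutes: "rotation n h permutes {1..n}"
proof -
  have "inj_on (rotation n h) {1..n}"
  proof (rule inj_onI)
    fix i j assume ij: "i \<in> {1..n}" "j \<in> {1..n}" and eq: "rotation n h i = rotation n h j"
    have "[i + h = j + h] (mod n)"
      using rotation_cong(2)[OF ij(1)] rotation_cong(2)[OF ij(2)] eq by (metis cong_sym cong_trans)
    then have "[i = j] (mod n)" by (simp add: cong_add_rcancel_nat)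
    then have "[i - 1 = j - 1] (mod n)"
      using ij by (metis atLeastAtMost_iff cong_add_rcancel_nat le_add_diff_inverse2)
    moreover have "i - 1 < n" "j - 1 < n" using ij by auto
    ultimately have "i - 1 = j - 1" by (simp add: cong_def)
    then show "i = j" using ij by auto
  qed
  moreover have "rotation n h ` {1..n} \<subseteq> {1..n}" using rotation_cong(1) by blast
  ultimately have "bij_betw (rotation n h) {1..n} {1..n}"
    by (simp add: bij_betw_def endo_inj_surj)
  then show ?thesis
    by (rule bij_imp_permutes) (auto simp: rotation_def)
qed

text \<open>
  \<open>canonical_cycles n p\<close> is a cycle form of \<open>p\<close> (fixed points included) in which every cycle starts
  with its least element and these leading elements decrease.
\<close>

lemma finite_cycle_leaders: "finite (cycle_leaders n p)"
  by (simp add: cycle_leaders_def)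

lemma permutes_interval_permutation: "p permutes {1..n::nat} \<Longrightarrow> permutation p"
  by (auto simp: permutation_permutes)

lemma hd_support:
  assumes "permutation p" shows "support p a \<noteq> []" and "hd (support p a) = a"
  using least_power_of_permutation(2)[OF assms, of a] by (simp_all add: hd_map)

lemma canonical_cycles_leader:
  assumes "p permutes {1..n}" "c \<in> set (canonical_cycles n p)"
  shows "c \<noteq> []" and "hd c = Min (set c)" and "distinct c"
    and "\<And>x. x \<in> set c \<Longrightarrow> p x = cycle_of_list c x"
proof -
  note perm = permutes_interval_permutation[OF assms(1)]
  obtain a where a: "a \<in> cycle_leaders n p" and c: "c = support p a"
    using assms(2) finite_cycle_leaders by (auto simp: canonical_cycles_def)
  show "c \<noteq> []" unfolding c by (rule hd_support[OF perm])
  have "hd c = a" unfolding c by (rule hd_support(2)[OF perm])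
  moreover have "a = Min (set c)" using a unfolding cycle_leaders_def c by blast
  ultimately show "hd c = Min (set c)" by (rule trans)
  show "distinct c" unfolding c by (rule cycle_of_permutation[OF perm])
  show "\<And>x. x \<in> set c \<Longrightarrow> p x = cycle_of_list c x"
    unfolding c by (rule cycle_restrict[OF perm])
qed

lemma canonical_cycles_decreasing:
  assumes "p permutes {1..n}"
  shows "sorted_wrt (>) (map hd (canonical_cycles n p))"
proof -
  note perm = permutes_interval_permutation[OF assms]
  have "map hd (canonical_cycles n p) = rev (sorted_list_of_set (cycle_leaders n p))"
    unfolding canonical_cycles_def map_map
    by (rule map_idI) (simp only: comp_def hd_support(2)[OF perm])
  then show ?thesis by (simp add: sorted_wrt_rev)
qed

lemma set_support_eq:
  assumes "permutation p" "x \<in> set (support p a)"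
  shows "set (support p x) = set (support p a)"
proof -
  have "x \<in> set (support p x)"
    using hd_support[OF assms(1), of x] by (metis hd_in_set)
  then show ?thesis
    using disjoint_support[OF assms(1)] assms(2) unfolding disjoint_def by blast
qed

lemma set_concat_canonical_cycles:
  assumes "p permutes {1..n}"
  shows "set (concat (canonical_cycles n p)) = {1..n}"
proof -
  note perm = permutes_interval_permutation[OF assms]
  have sub: "set (support p a) \<subseteq> {1..n}" if "a \<in> {1..n}" for a
    using permutes_in_image[OF permutes_funpow[OF assms]] that by auto
  have "\<exists>a \<in> cycle_leaders n p. x \<in> set (support p a)" if x: "x \<in> {1..n}" for x
  proof -
    let ?a = "Min (set (support p x))"
    have xs: "x \<in> set (support p x)" using hd_support[OF perm, of x] by (metis hd_in_set)
    have a: "?a \<in> set (support p x)" using xs Min_in[OF finite_set] by (metis empty_iff)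
    note eq = set_support_eq[OF perm a]
    have "?a \<in> cycle_leaders n p"
      unfolding cycle_leaders_def mem_Collect_eq eq using a sub[OF x] by blast
    then show ?thesis using xs eq by blast
  qed
  moreover have "cycle_leaders n p \<subseteq> {1..n}" by (auto simp: cycle_leaders_def)
  ultimately have "(\<Union>a \<in> cycle_leaders n p. set (support p a)) = {1..n}"
    using sub by blast
  then show ?thesis using finite_cycle_leaders by (simp add: canonical_cycles_def)
qed

lemma distinct_concat_canonical_cycles:
  assumes "p permutes {1..n}"
  shows "distinct (concat (canonical_cycles n p))"
proof (rule distinct_concat)
  note perm = permutes_interval_permutation[OF assms]
  have "inj (\<lambda>a. support p a)"
    by (rule injI) (metis hd_support(2)[OF perm])
  then show "distinct (canonical_cycles n p)"
    unfolding canonical_cycles_def distinct_map by (auto intro: inj_on_subset)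
next
  fix c assume "c \<in> set (canonical_cycles n p)"
  then show "distinct c" by (rule canonical_cycles_leader(3)[OF assms])
next
  fix c d assume cd: "c \<in> set (canonical_cycles n p)" "d \<in> set (canonical_cycles n p)" "c \<noteq> d"
  note perm = permutes_interval_permutation[OF assms]
  obtain a where a: "a \<in> cycle_leaders n p" "c = support p a"
    using cd(1) finite_cycle_leaders by (auto simp: canonical_cycles_def)
  obtain b where b: "b \<in> cycle_leaders n p" "d = support p b"
    using cd(2) finite_cycle_leaders by (auto simp: canonical_cycles_def)
  have "set c \<noteq> set d"
  proof
    assume "set c = set d"
    then have "hd c = hd d"
      using canonical_cycles_leader(2)[OF assms cd(1)] canonical_cycles_leader(2)[OF assms cd(2)]
      by simp
    then have "a = b" unfolding a(2) b(2) hd_support(2)[OF perm] .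
    then show False using a b cd(3) by simp
  qed
  then show "set c \<inter> set d = {}"
    using disjoint_support[OF perm] unfolding disjoint_def a(2) b(2) by blast
qed

lemma hat_permutes:
  assumes "p permutes {1..n}"
  shows "hat n p permutes {1..n}"
proof -
  let ?l = "concat (canonical_cycles n p)"
  have d: "distinct ?l" and s: "set ?l = {1..n}"
    using distinct_concat_canonical_cycles[OF assms] set_concat_canonical_cycles[OF assms] .
  then have len: "length ?l = n" by (metis card_atLeastAtMost diff_Suc_1 distinct_card)
  have "bij_betw (\<lambda>i. i - 1) {1..n} {..<n}"
    by (rule bij_betw_byWitness[where f' = Suc]) auto
  moreover have "bij_betw ((!) ?l) {..<n} {1..n}"
    using bij_betw_nth[OF d] len s by metis
  ultimately have "bij_betw ((!) ?l \<circ> (\<lambda>i. i - 1)) {1..n} {1..n}"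
    by (rule bij_betw_trans)
  then have "bij_betw (hat n p) {1..n} {1..n}"
    by (rule bij_betw_cong[THEN iffD1, rotated]) (simp add: hat_def)
  then show ?thesis
    by (rule bij_imp_permutes) (auto simp: hat_def)
qed

end

theory Submission
  imports Defs "HOL-Library.Sublist"
begin

text \<open>
  In the listing that defines \<open>hat n p\<close>, an entry and its successor either lie in one cycle, and
  then \<open>p\<close> maps the one to the other, or they straddle two cycles, and then the listing descends,
  since the successor leads a cycle with a smaller minimum. So for \<open>x < y\<close> the entry \<open>y\<close> comes
  directly after \<open>x\<close> iff \<open>p x = y\<close>: if \<open>p x = y > x\<close>, then \<open>y\<close> is not the least element of its
  cycle, so \<open>x\<close> is not written last in it. The rotation sends \<open>k \<le> n - h\<close> to \<open>k + h > k\<close>.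
\<close>

text \<open>Links two views of adjacency: \<open>sublist\<close> splits along \<open>concat\<close>,
  while indices match the positions that \<open>hat\<close> reads.\<close>

lemma sublist_pair_iff_nth:
  "sublist [x, y] l \<longleftrightarrow> (\<exists>i. Suc i < length l \<and> l ! i = x \<and> l ! Suc i = y)"
proof
  assume "sublist [x, y] l"
  then obtain us vs where l: "l = us @ [x, y] @ vs" by (auto simp: sublist_def)
  show "\<exists>i. Suc i < length l \<and> l ! i = x \<and> l ! Suc i = y"
    by (rule exI[of _ "length us"]) (simp add: l nth_append)
next
  assume "\<exists>i. Suc i < length l \<and> l ! i = x \<and> l ! Suc i = y"
  then obtain i where i: "Suc i < length l" "l ! i = x" "l ! Suc i = y" by blast
  then have "l = take i l @ [x, y] @ drop (Suc (Suc i)) l"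
    by (metis Cons_nth_drop_Suc Suc_lessD append_Cons append_Nil append_take_drop_id)
  then show "sublist [x, y] l" unfolding sublist_def by blast
qed

lemma sublist_ascent_concat_iff:
  fixes cs :: "'a::linorder list list"
  assumes "\<And>c. c \<in> set cs \<Longrightarrow> c \<noteq> [] \<and> hd c = Min (set c)"
    and "sorted_wrt (>) (map hd cs)" and "x < y"
  shows "sublist [x, y] (concat cs) \<longleftrightarrow> (\<exists>c \<in> set cs. sublist [x, y] c)"
  using assms(1,2)
proof (induction cs)
  case Nil
  then show ?case by simp
next
  case (Cons c cs)
  have IH: "sublist [x, y] (concat cs) \<longleftrightarrow> (\<exists>c \<in> set cs. sublist [x, y] c)"
    using Cons by simp
  have "\<not> (suffix [x] c \<and> prefix [y] (concat cs))"
  proof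
    assume *: "suffix [x] c \<and> prefix [y] (concat cs)"
    then obtain d ds where cs: "cs = d # ds" by (cases cs) auto
    \<comment> \<open>As \<open>d\<close> is nonempty, the first entry of \<open>concat cs\<close>
      is the leader of the next cycle.\<close>
    have "d \<noteq> []" using Cons.prems(1) cs by simp
    then have "y = hd d" using * cs by (cases d) auto
    also have "\<dots> < hd c" using Cons.prems(2) cs by simp
    also have "\<dots> = Min (set c)" using Cons.prems(1) by simp
    also have "\<dots> \<le> x" using * by (auto simp: suffix_def)
    finally show False using \<open>x < y\<close> by simp
  qed
  \<comment> \<open>A split with an empty half puts the pair inside \<open>c\<close> or inside
    \<open>concat cs\<close>; only the split \<open>[x]\<close>, \<open>[y]\<close> straddles the
    border, and it was just excluded.\<close>
  moreover have "[x, y] = us @ vs \<longleftrightarrow>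
      us = [] \<and> vs = [x, y] \<or> us = [x] \<and> vs = [y] \<or> us = [x, y] \<and> vs = []" for us vs
    by (auto simp: Cons_eq_append_conv)
  ultimately have "sublist [x, y] (c @ concat cs) \<longleftrightarrow>
      sublist [x, y] c \<or> sublist [x, y] (concat cs)"
    unfolding sublist_append by (metis prefix_imp_sublist suffix_imp_sublist)
  then show ?case using IH by simp
qed

lemma sublist_support_iff:
  assumes "permutation p" and "a = Min (set (support p a))" and "x < y"
  shows "sublist [x, y] (support p a) \<longleftrightarrow> x \<in> set (support p a) \<and> p x = y"
proof
  assume "sublist [x, y] (support p a)"
  then show "x \<in> set (support p a) \<and> p x = y"
    by (auto simp: sublist_pair_iff_nth)
next
  let ?m = "least_power p a"
  assume *: "x \<in> set (support p a) \<and> p x = y"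
  then obtain i where i: "i < ?m" "x = (p ^^ i) a" by auto
  \<comment> \<open>At the last index \<open>p\<close> would close the cycle, so \<open>y\<close>
    would be its minimum \<open>a\<close>, which is at most \<open>x\<close>. Hence index
    \<open>Suc i\<close> is still inside the list.\<close>
  have "Suc i \<noteq> ?m"
  proof
    assume "Suc i = ?m"
    then have "y = (p ^^ ?m) a" using * i(2) by (metis comp_apply funpow.simps(2))
    also have "\<dots> = a" by (rule least_power_of_permutation(1)[OF assms(1)])
    also have "\<dots> \<le> x" using assms(2) * by (metis List.finite_set Min_le)
    finally show False using \<open>x < y\<close> by simp
  qed
  then show "sublist [x, y] (support p a)"
    using i * by (auto simp: sublist_pair_iff_nth intro!: exI[of _ i])
qed

text \<open>Entries of the listing are distinct, so an adjacent occurrence of \<open>x\<close> and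
  \<open>y\<close> can only be at their unique positions.\<close>

lemma inv_hat_Suc_iff:
  assumes p: "p permutes {1..n}" and "x \<in> {1..n}" and "y \<in> {1..n}"
  shows "inv (hat n p) y = inv (hat n p) x + 1 \<longleftrightarrow> sublist [x, y] (concat (canonical_cycles n p))"
proof -
  let ?l = "concat (canonical_cycles n p)" and ?g = "inv (hat n p)"
  have d: "distinct ?l" and len: "length ?l = n"
    using distinct_concat_canonical_cycles[OF p] set_concat_canonical_cycles[OF p]
    by (simp, metis card_atLeastAtMost diff_Suc_1 distinct_card)
  \<comment> \<open>Positions under \<open>hat\<close> start at 1, list indices at 0; the offset is
    the same for \<open>x\<close> and \<open>y\<close>.\<close>
  have "\<exists>i < n. ?g z = Suc i \<and> ?l ! i = z" if "z \<in> {1..n}" for z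
  proof -
    have "?g z \<in> {1..n}" "hat n p (?g z) = z"
      using hat_permutes[OF p] that
      by (metis permutes_in_image permutes_inv, metis permutes_inverses(1))
    then show ?thesis by (intro exI[of _ "?g z - 1"]) (auto simp: hat_def)
  qed
  then obtain i j where "i < n" "?g x = Suc i" "?l ! i = x" "j < n" "?g y = Suc j" "?l ! j = y"
    using assms(2,3) by meson
  then show ?thesis
    using nth_eq_iff_index_eq[OF d] unfolding sublist_pair_iff_nth len
    by (metis Suc_eq_plus1 Suc_lessD nat.inject)
qed

lemma inv_hat_ascent_iff:
  assumes p: "p permutes {1..n}" and "x \<in> {1..n}" and "y \<in> {1..n}" and "x < y"
  shows "inv (hat n p) y = inv (hat n p) x + 1 \<longleftrightarrow> p x = y"
proof -
  note perm = permutes_interval_permutation[OF p]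
  let ?cs = "canonical_cycles n p"
  have "sublist [x, y] (concat ?cs) \<longleftrightarrow> (\<exists>c \<in> set ?cs. sublist [x, y] c)"
    using sublist_ascent_concat_iff[OF _ canonical_cycles_decreasing[OF p] \<open>x < y\<close>]
      canonical_cycles_leader(1,2)[OF p] by blast
  also have "\<dots> \<longleftrightarrow> (\<exists>c \<in> set ?cs. x \<in> set c \<and> p x = y)"
  proof (rule bex_cong[OF refl])
    fix c assume "c \<in> set ?cs"
    then obtain a where "a = Min (set (support p a))" "c = support p a"
      using finite_cycle_leaders unfolding canonical_cycles_def cycle_leaders_def by auto
    then show "sublist [x, y] c \<longleftrightarrow> x \<in> set c \<and> p x = y"
      using sublist_support_iff[OF perm _ \<open>x < y\<close>] by blast
  qed
  \<comment> \<open>The cycles cover \<open>{1..n}\<close>, so some cycle contains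
    \<open>x\<close>.\<close>
  also have "\<dots> \<longleftrightarrow> p x = y"
    using set_concat_canonical_cycles[OF p] \<open>x \<in> {1..n}\<close> by auto
  finally show ?thesis using inv_hat_Suc_iff[OF assms(1-3)] by simp
qed

theorem theorem4p1:
  fixes n h :: nat and \<pi> :: "nat \<Rightarrow> nat"
  assumes "1 \<le> h" and "h < n"
    and "\<pi> permutes {1..n}"
  shows "{k \<in> {1..n - h}. inv (hat n (rotation n h \<circ> \<pi>)) (k + h)
                           = inv (hat n (rotation n h \<circ> \<pi>)) k + 1}
       = {k \<in> {1..n - h}. \<pi> k = k}"
proof (rule Collect_cong, rule conj_cong[OF refl])
  fix k assume k: "k \<in> {1..n - h}"
  let ?p = "rotation n h \<circ> \<pi>"
  have "?p permutes {1..n}" using assms(3) rotation_permutes by (rule permutes_compose)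
  then have "inv (hat n ?p) (k + h) = inv (hat n ?p) k + 1 \<longleftrightarrow> ?p k = k + h"
    using k assms(1,2) by (intro inv_hat_ascent_iff) auto
  \<comment> \<open>Since \<open>k + h \<le> n\<close>, the rotation does not wrap around at
    \<open>k\<close>: \<open>k + h\<close> is the image of \<open>k\<close>, and injectivity can
    then cancel the rotation.\<close>
  also have "?p k = k + h \<longleftrightarrow> rotation n h (\<pi> k) = rotation n h k"
    using k assms(1,2) by (auto simp: rotation_def)
  also have "\<dots> \<longleftrightarrow> \<pi> k = k"
    using permutes_inj[OF rotation_permutes] by (rule inj_eq)
  finally show "inv (hat n ?p) (k + h) = inv (hat n ?p) k + 1 \<longleftrightarrow> \<pi> k = k" .
qed

end
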